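(* Let $n\ge2$ and let $\mathbf A$ be a real $n\times n$ $\mathcal J$-sign-symmetric matrix whose second compound matrix $\mathbf A^{(2)}$ is also $\mathcal J$-sign-symmetric. Let $\mathcal J\subseteq\{1,\dots,n\}$ and $\widetilde{\mathcal J}\subseteq\{1,\dots,\binom n2\}$ be sets witnessing the $\mathcal J$-sign-symmetricity of $\mathbf A$ and of $\mathbf A^{(2)}$ respectively, and suppose that the associated set $\widehat W(\mathcal J,\widetilde{\mathcal J})$ is transitive. Then there exists a sequence $\{\mathbf A_m\}$ of strictly $\mathcal J$-sign-symmetric matrices with strictly $\mathcal J$-sign-symmetric second compound matrices which converges to $\mathbf A$.
   Context: A real $m\times m$ matrix $\mathbf B=(b_{ij})$ is $\mathcal J$-sign-symmetric if there is a subset $\mathcal J\subseteq\{1,\dots,m\}$ (a witness) such that $b_{ij}\le 0$ whenever exactly one of $i,j$ belongs to $\mathcal J$, and $b_{ij}<0$ only if exactly one of $i,j$ belongs to $\mathcal J$. It is strictly $\mathcal J$-sign-symmetric if it has no zero entries and there is a subset $\mathcal J\subseteq\{1,\dots,m\}$ such that $b_{ij}<0$ if and only if exactly one of $i,j$ belongs to $\mathcal J$. The second compound matrix $\mathbf A^{(2)}$ is the $\binom n2\times\binom n2$ matrix of minors $A\begin{pmatrix} i&j\\k&l\end{pmatrix}=a_{ik}a_{jl}-a_{il}a_{jk}$, with rows indexed by pairs $(i,j)$, $i<j$, and columns by pairs $(k,l)$, $k<l$, pairs being numbered $1,\dots,\binom n2$ in lexicographic order. The set $\widehat W(\mathcal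 J,\widetilde{\mathcal J})\subseteq\{1,\dots,n\}\times\{1,\dots,n\}$ contains all pairs $(i,i)$, and for $i\ne j$ a pair $(i,j)$ belongs to it if and only if one of the following holds: (a) $i<j$, the numbers $i,j$ are both in $\mathcal J$ or both in $\{1,\dots,n\}\setminus\mathcal J$, and the lexicographic number of $(i,j)$ lies in $\widetilde{\mathcal J}$; (b) $i<j$, exactly one of $i,j$ lies in $\mathcal J$, and the lexicographic number of $(i,j)$ does not lie in $\widetilde{\mathcal J}$; (c) $i>j$, the numbers $i,j$ are both in $\mathcal J$ or both in $\{1,\dots,n\}\setminus\mathcal J$, and the lexicographic number of $(j,i)$ does not lie in $\widetilde{\mathcal J}$; (d) $i>j$, exactly one of $i,j$ lies in $\mathcal J$, and the lexicographic number of $(j,i)$ lies in $\widetilde{\mathcal J}$. The set is called transitive if the binary relation $i\prec j\iff(i,j)\in\widehat W(\mathcal J,\widetilde{\mathcal J})$ is a linear order on $\{1,\dots,n\}$. *)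

theory Defs
  imports Complex_Main "Jordan_Normal_Form.Matrix"
begin

text \<open>
  Rows, columns and pairs are numbered from 0, as usual for matrices in this library, so that
  the index sets \<open>{1,\<dots>,m}\<close> of the informal text become \<open>{0..<m}\<close>.
\<close>

definition exactly_one_in :: "nat \<Rightarrow> nat \<Rightarrow> nat set \<Rightarrow> bool" where
  "exactly_one_in i j J \<longleftrightarrow> (i \<in> J) \<noteq> (j \<in> J)"

definition sign_symmetric_witness :: "real mat \<Rightarrow> nat set \<Rightarrow> bool" where
  "sign_symmetric_witness B J \<longleftrightarrow>
     square_mat B \<and> J \<subseteq> {0..<dim_row B} \<and>
     (\<forall>i<dim_row B. \<forall>j<dim_row B.
        (exactly_one_in i j J \<longrightarrow> B $$ (i, j) \<le> 0) \<and>
        (B $$ (i, j) < 0 \<longrightarrow> exactly_one_in i j J))"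

definition strictly_sign_symmetric :: "real mat \<Rightarrow> bool" where
  "strictly_sign_symmetric B \<longleftrightarrow>
     square_mat B \<and>
     (\<forall>i<dim_row B. \<forall>j<dim_row B. B $$ (i, j) \<noteq> 0) \<and>
     (\<exists>J \<subseteq> {0..<dim_row B}. \<forall>i<dim_row B. \<forall>j<dim_row B.
        B $$ (i, j) < 0 \<longleftrightarrow> exactly_one_in i j J)"

definition lex_pairs :: "nat \<Rightarrow> (nat \<times> nat) list" where
  "lex_pairs n = [(i, j). i \<leftarrow> [0..<n], j \<leftarrow> [Suc i..<n]]"

definition lex_number :: "nat \<Rightarrow> nat \<times> nat \<Rightarrow> nat" where
  "lex_number n p = (THE r. r < length (lex_pairs n) \<and> lex_pairs n ! r = p)"

definition minor2 :: "real mat \<Rightarrow> nat \<times> nat \<Rightarrow> nat \<times> nat \<Rightarrow> real" where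
  "minor2 A = (\<lambda>(i, j) (k, l). A $$ (i, k) * A $$ (j, l) - A $$ (i, l) * A $$ (j, k))"

definition second_compound :: "real mat \<Rightarrow> real mat" where
  "second_compound A = (let n = dim_row A in
     mat (n choose 2) (n choose 2) (\<lambda>(r, s). minor2 A (lex_pairs n ! r) (lex_pairs n ! s)))"

definition W_hat :: "nat \<Rightarrow> nat set \<Rightarrow> nat set \<Rightarrow> (nat \<times> nat) set" where
  "W_hat n J J2 = {(i, j). i < n \<and> j < n \<and>
     (i = j \<or>
      i < j \<and> \<not> exactly_one_in i j J \<and> lex_number n (i, j) \<in> J2 \<or>
      i < j \<and> exactly_one_in i j J \<and> lex_number n (i, j) \<notin> J2 \<or>
      i > j \<and> \<not> exactly_one_in i j J \<and> lex_number n (j, i) \<notin> J2 \<or>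
      i > j \<and> exactly_one_in i j J \<and> lex_number n (j, i) \<in> J2)}"

definition W_hat_transitive :: "nat \<Rightarrow> nat set \<Rightarrow> nat set \<Rightarrow> bool" where
  "W_hat_transitive n J J2 \<longleftrightarrow> linear_order_on {0..<n} (W_hat n J J2)"

lemma length_lex_pairs: "length (lex_pairs n) = n choose 2"
proof -
  have "length (lex_pairs n) = (\<Sum>i\<leftarrow>[0..<n]. n - Suc i)"
    unfolding lex_pairs_def by (simp add: length_concat comp_def)
  also have "\<dots> = (\<Sum>i<n. n - Suc i)"
    by (simp add: interv_sum_list_conv_sum_set_nat atLeast0LessThan)
  also have "\<dots> = (\<Sum>i<n. i)"
    by (rule sum.nat_diff_reindex)
  also have "\<dots> = n choose 2"
    by (induction n) (simp_all add: numeral_2_eq_2)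
  finally show ?thesis .
qed

lemma set_lex_pairs: "set (lex_pairs n) = {(i, j). i < j \<and> j < n}"
  unfolding lex_pairs_def by (force simp: image_iff)

lemma sorted_lex_pairs:
  "sorted_wrt (\<lambda>(i, j) (k, l). i < k \<or> i = k \<and> j < l) (lex_pairs n)"
proof -
  have aux: "sorted_wrt (\<lambda>(i, j) (k, l). i < k \<or> i = k \<and> j < l)
    (concat (map (\<lambda>i. map (Pair i) [Suc i..<n]) [0..<m]))" for m
  proof (induction m)
    case (Suc m)
    have "sorted_wrt (\<lambda>(i, j) (k, l). i < k \<or> i = k \<and> j < l) (map (Pair m) [Suc m..<n])"
      by (simp add: sorted_wrt_map)
    with Suc show ?case by (auto simp: sorted_wrt_append)
  qed simp
  show ?thesis using aux[of n] by (simp add: lex_pairs_def)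
qed

lemma distinct_lex_pairs: "distinct (lex_pairs n)"
proof -
  have "lex_pairs n ! r \<noteq> lex_pairs n ! s"
    if "r < s" "s < length (lex_pairs n)" for r s
    using sorted_wrt_nth_less[OF sorted_lex_pairs that] by (auto split: prod.splits)
  then show ?thesis
    unfolding distinct_conv_nth by (metis linorder_neqE_nat)
qed

lemma lex_number_nth:
  assumes "r < n choose 2"
  shows "lex_number n (lex_pairs n ! r) = r"
  unfolding lex_number_def
  using assms distinct_lex_pairs[of n]
  by (intro the_equality) (auto simp: length_lex_pairs nth_eq_iff_index_eq)

lemma lex_pairs_nth_lex_number:
  assumes "i < j" "j < n"
  shows "lex_number n (i, j) < n choose 2" "lex_pairs n ! lex_number n (i, j) = (i, j)"
proof -
  have "(i, j) \<in> set (lex_pairs n)" using assms by (simp add: set_lex_pairs)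
  then obtain r where "r < n choose 2" "lex_pairs n ! r = (i, j)"
    by (auto simp: in_set_conv_nth length_lex_pairs)
  with lex_number_nth[of r n]
  show "lex_number n (i, j) < n choose 2" "lex_pairs n ! lex_number n (i, j) = (i, j)"
    by auto
qed

end

theory Submission imports Defs begin

text \<open>
  Conjugating \<open>A\<close> by the diagonal matrix of the signs given by \<open>J\<close> makes it entrywise nonnegative.
  Transitivity of the set \<open>W_hat\<close> then says exactly that, after reordering the indices along the
  associated linear order (encoded by a rank function \<open>\<rho>\<close>), all minors of order two become
  nonnegative too.  Such a matrix is approximated by matrices \<open>G A G\<close> with positive entries, where
  \<open>G\<close> has the entries \<open>t\<^bsup>|\<rho> i - \<rho> j|\<^esup>\<close> and tends to the identity as \<open>t\<close> tends to \<open>0\<close>.  Once the entries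
  are positive, multiplying the \<open>(i, j)\<close> entry by \<open>exp (\<epsilon> \<rho> i \<rho> j)\<close> makes all minors strictly positive.
\<close>

section \<open>Sign patterns and the numbering of pairs\<close>

definition sign_of :: "nat set \<Rightarrow> nat \<Rightarrow> real" where
  "sign_of S i = (if i \<in> S then -1 else 1)"

text \<open>The product of the two signs is -1 exactly when one of the two indices lies in
  \<open>S\<close>, so conjugation by the diagonal sign matrix removes every negative entry.\<close>

lemma sign_symmetric_witness_nonneg:
  assumes "sign_symmetric_witness B S" "i < dim_row B" "j < dim_row B"
  shows "0 \<le> sign_of S i * sign_of S j * B $$ (i, j)"
  using assms
  by (auto simp: sign_symmetric_witness_def sign_of_def exactly_one_in_def not_less[symmetric])

lemma strictly_sign_symmetricI:
  assumes "square_mat B" "S \<subseteq> {0..<dim_row B}"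
    and "\<And>i j. i < dim_row B \<Longrightarrow> j < dim_row B \<Longrightarrow> 0 < sign_of S i * sign_of S j * B $$ (i, j)"
  shows "strictly_sign_symmetric B"
proof -
  have "B $$ (i, j) \<noteq> 0 \<and> (B $$ (i, j) < 0 \<longleftrightarrow> exactly_one_in i j S)"
    if "i < dim_row B" "j < dim_row B" for i j
    using assms(3)[OF that] by (auto simp: sign_of_def exactly_one_in_def split: if_splits)
  then show ?thesis
    using assms(1,2) unfolding strictly_sign_symmetric_def by blast
qed

lemma dim_second_compound [simp]:
  "dim_row (second_compound A) = dim_row A choose 2"
  "dim_col (second_compound A) = dim_row A choose 2"
  by (simp_all add: second_compound_def Let_def)

lemma second_compound_nth:
  assumes "r < dim_row A choose 2" "s < dim_row A choose 2"
  shows "second_compound A $$ (r, s) =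
    minor2 A (lex_pairs (dim_row A) ! r) (lex_pairs (dim_row A) ! s)"
  using assms by (simp add: second_compound_def Let_def)

lemma lex_pairs_nthE:
  assumes "r < n choose 2"
  obtains i j where "i < j" "j < n" "lex_pairs n ! r = (i, j)" "lex_number n (i, j) = r"
proof -
  have "lex_pairs n ! r \<in> set (lex_pairs n)"
    using assms by (simp add: length_lex_pairs)
  moreover have "lex_number n (lex_pairs n ! r) = r"
    using assms by (rule lex_number_nth)
  ultimately show ?thesis
    using that by (auto simp: set_lex_pairs)
qed

text \<open>Counting strict predecessors turns the abstract order into numbers, so that distances
  and products of ranks become available below.\<close>

lemma linear_order_rank:
  fixes r :: "('a \<times> 'a) set"
  assumes "finite X" "linear_order_on X r"
  obtains \<rho> :: "'a \<Rightarrow> nat"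
  where "inj_on \<rho> X" "\<And>i j. i \<in> X \<Longrightarrow> j \<in> X \<Longrightarrow> i \<noteq> j \<Longrightarrow> (i, j) \<in> r \<longleftrightarrow> \<rho> i < \<rho> j"
proof -
  define \<rho> where "\<rho> i = card {k \<in> X. (k, i) \<in> r \<and> k \<noteq> i}" for i
  have tr: "trans r" and an: "antisym r" and tot: "total_on X r"
    using assms(2) by (auto simp: linear_order_on_def partial_order_on_def preorder_on_def)
  have mono: "\<rho> i < \<rho> j" if "i \<in> X" "j \<in> X" "i \<noteq> j" "(i, j) \<in> r" for i j
    unfolding \<rho>_def
  proof (rule psubset_card_mono)
    \<comment> \<open>The inclusion is strict because \<open>i\<close> belongs to the right-hand set
      only; antisymmetry rules out \<open>k = j\<close>.\<close>
    show "{k \<in> X. (k, i) \<in> r \<and> k \<noteq> i} \<subset> {k \<in> X. (k, j) \<in> r \<and> k \<noteq> j}"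
      using that transD[OF tr] antisymD[OF an] by blast
  qed (use assms(1) in simp)
  have iff: "(i, j) \<in> r \<longleftrightarrow> \<rho> i < \<rho> j" if "i \<in> X" "j \<in> X" "i \<noteq> j" for i j
    using that mono tot unfolding total_on_def by (metis less_asym)
  moreover have "inj_on \<rho> X"
    using tot mono unfolding total_on_def inj_on_def by (metis less_irrefl)
  ultimately show ?thesis using that by blast
qed

section \<open>Nonnegative minors of order two along a rank\<close>

definition minors2_nonneg :: "'a set \<Rightarrow> ('a \<Rightarrow> nat) \<Rightarrow> ('a \<Rightarrow> 'a \<Rightarrow> real) \<Rightarrow> bool" where
  "minors2_nonneg X \<rho> f \<longleftrightarrow> (\<forall>i\<in>X. \<forall>j\<in>X. \<forall>k\<in>X. \<forall>l\<in>X.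
     \<rho> i < \<rho> j \<longrightarrow> \<rho> k < \<rho> l \<longrightarrow> f i l * f j k \<le> f i k * f j l)"

lemma minors2_nonnegD:
  assumes "minors2_nonneg X \<rho> f" "i \<in> X" "j \<in> X" "k \<in> X" "l \<in> X" "\<rho> i < \<rho> j" "\<rho> k < \<rho> l"
  shows "f i l * f j k \<le> f i k * f j l"
  using assms unfolding minors2_nonneg_def by blast

text \<open>Symmetrising the double sum in the two summation indices gives the Cauchy--Binet formula.\<close>

lemma minors2_nonneg_mult:
  assumes inj: "inj_on \<rho> X"
    and f: "minors2_nonneg X \<rho> f" and g: "minors2_nonneg X \<rho> g"
  shows "minors2_nonneg X \<rho> (\<lambda>i k. \<Sum>p\<in>X. f i p * g p k)"
  unfolding minors2_nonneg_def
proof (intro ballI impI)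
  fix i j k l
  assume ij: "i \<in> X" "j \<in> X" "\<rho> i < \<rho> j" and kl: "k \<in> X" "l \<in> X" "\<rho> k < \<rho> l"
  let ?h = "\<lambda>p q. f i p * g p k * (f j q * g q l) - f i p * g p l * (f j q * g q k)"
  let ?d = "(\<Sum>p\<in>X. f i p * g p k) * (\<Sum>q\<in>X. f j q * g q l)
          - (\<Sum>p\<in>X. f i p * g p l) * (\<Sum>q\<in>X. f j q * g q k)"
  have d: "?d = (\<Sum>p\<in>X. \<Sum>q\<in>X. ?h p q)"
    by (simp add: sum_product sum_subtractf)
  also have "\<dots> = (\<Sum>p\<in>X. \<Sum>q\<in>X. ?h q p)"
    by (rule sum.swap)
  finally have "2 * ?d = (\<Sum>p\<in>X. \<Sum>q\<in>X. ?h p q + ?h q p)"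
    using d by (simp add: sum.distrib)
  also have "\<dots> = (\<Sum>p\<in>X. \<Sum>q\<in>X. (f i p * f j q - f i q * f j p) * (g p k * g q l - g p l * g q k))"
    by (intro sum.cong refl) (simp add: algebra_simps)
  also have "\<dots> \<ge> 0"
  proof (intro sum_nonneg)
    fix p q assume pq: "p \<in> X" "q \<in> X"
    \<comment> \<open>Exchanging \<open>p\<close> and \<open>q\<close> flips the signs of both
      factors, so their product is nonnegative in either order.\<close>
    consider "p = q" | "\<rho> p < \<rho> q" | "\<rho> q < \<rho> p"
      using inj pq by (metis inj_onD linorder_neqE_nat)
    then show "0 \<le> (f i p * f j q - f i q * f j p) * (g p k * g q l - g p l * g q k)"
    proof cases
      case 2
      show ?thesis
        using minors2_nonnegD[OF f ij(1,2) pq ij(3) 2] minors2_nonnegD[OF g pq kl(1,2) 2 kl(3)]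
        by (intro mult_nonneg_nonneg) auto
    next
      case 3
      show ?thesis
        using minors2_nonnegD[OF f ij(1,2) pq(2,1) ij(3) 3]
          minors2_nonnegD[OF g pq(2,1) kl(1,2) 3 kl(3)]
        by (intro mult_nonpos_nonpos) (auto simp: mult.commute)
    qed simp
  qed
  finally show "(\<Sum>p\<in>X. f i p * g p l) * (\<Sum>p\<in>X. f j p * g p k)
      \<le> (\<Sum>p\<in>X. f i p * g p k) * (\<Sum>p\<in>X. f j p * g p l)"
    by simp
qed

section \<open>Approximation by positive entries and positive minors\<close>

definition distance_kernel :: "('a \<Rightarrow> nat) \<Rightarrow> real \<Rightarrow> 'a \<Rightarrow> 'a \<Rightarrow> real" where
  "distance_kernel \<rho> t i j = t ^ nat \<bar>int (\<rho> i) - int (\<rho> j)\<bar>"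

text \<open>For a < b and c < d, matching in order is cheapest: |a - c| + |b - d| is at most |a - d|
  + |b - c|. Powers of \<open>t\<close> decrease in the exponent, which reverses the
  inequality.\<close>

lemma minors2_nonneg_distance_kernel:
  assumes "0 < t" "t \<le> 1"
  shows "minors2_nonneg X \<rho> (distance_kernel \<rho> t)"
  unfolding minors2_nonneg_def
proof (intro ballI impI)
  fix i j k l
  assume "\<rho> i < \<rho> j" "\<rho> k < \<rho> l"
  then have "nat \<bar>int (\<rho> i) - int (\<rho> k)\<bar> + nat \<bar>int (\<rho> j) - int (\<rho> l)\<bar>
      \<le> nat \<bar>int (\<rho> i) - int (\<rho> l)\<bar> + nat \<bar>int (\<rho> j) - int (\<rho> k)\<bar>"
    by (simp add: nat_add_distrib[symmetric])
  then show "distance_kernel \<rho> t i l * distance_kernel \<rho> t j k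
      \<le> distance_kernel \<rho> t i k * distance_kernel \<rho> t j l"
    using assms by (simp add: distance_kernel_def power_add[symmetric] power_decreasing)
qed

lemma tendsto_distance_kernel:
  assumes "t \<longlonglongrightarrow> 0" "inj_on \<rho> X" "i \<in> X" "j \<in> X"
  shows "(\<lambda>m. distance_kernel \<rho> (t m) i j) \<longlonglongrightarrow> (if i = j then 1 else 0)"
proof (cases "i = j")
  case False
  \<comment> \<open>Injectivity keeps the exponent positive off the diagonal; with exponent 0 the
    limit would be 1.\<close>
  then have "\<rho> i \<noteq> \<rho> j" using assms by (auto dest: inj_onD)
  then have "(0::real) ^ nat \<bar>int (\<rho> i) - int (\<rho> j)\<bar> = 0" by (simp add: power_0_left)
  with tendsto_power[OF assms(1), of "nat \<bar>int (\<rho> i) - int (\<rho> j)\<bar>"] False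
  show ?thesis by (simp add: distance_kernel_def)
qed (simp add: distance_kernel_def)

text \<open>The zero matrix is the exceptional case: there the smoothed matrices \<open>G A G\<close> vanish as well.\<close>

lemma minors2_nonneg_positive_approximation:
  assumes X: "finite X" and inj: "inj_on \<rho> X"
    and nonneg: "\<And>i j. i \<in> X \<Longrightarrow> j \<in> X \<Longrightarrow> 0 \<le> f i j"
    and f: "minors2_nonneg X \<rho> f"
  obtains F :: "nat \<Rightarrow> 'a \<Rightarrow> 'a \<Rightarrow> real" where
    "\<And>m i j. i \<in> X \<Longrightarrow> j \<in> X \<Longrightarrow> 0 < F m i j"
    "\<And>m. minors2_nonneg X \<rho> (F m)"
    "\<And>i j. i \<in> X \<Longrightarrow> j \<in> X \<Longrightarrow> (\<lambda>m. F m i j) \<longlonglongrightarrow> f i j"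
proof (cases "\<forall>i\<in>X. \<forall>j\<in>X. f i j = 0")
  case True
  show ?thesis
  \<comment> \<open>All minors of a constant matrix vanish, so positive constants tending to 0
    suffice.\<close>
  proof (rule that[of "\<lambda>m i j. inverse (real (Suc m))"])
    show "(\<lambda>m. inverse (real (Suc m))) \<longlonglongrightarrow> f i j" if "i \<in> X" "j \<in> X" for i j
      using True that LIMSEQ_inverse_real_of_nat by simp
  qed (auto simp: minors2_nonneg_def)
next
  case False
  then obtain a b where ab: "a \<in> X" "b \<in> X" "f a b \<noteq> 0" by blast
  \<comment> \<open>The parameter stays in (0, 1], as the minors of the kernel require, and tends to
    0.\<close>
  define G where "G m = distance_kernel \<rho> (inverse (real (Suc m)))" for m
  have G_pos: "0 < G m i j" for m i j
    by (simp add: G_def distance_kernel_def)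
  have G_minors: "minors2_nonneg X \<rho> (G m)" for m
    unfolding G_def by (intro minors2_nonneg_distance_kernel) (auto simp: field_simps)
  have G_lim: "(\<lambda>m. G m i j) \<longlonglongrightarrow> (if i = j then 1 else 0)" if "i \<in> X" "j \<in> X" for i j
    unfolding G_def using LIMSEQ_inverse_real_of_nat inj that by (rule tendsto_distance_kernel)
  define F where "F m i j = (\<Sum>p\<in>X. G m i p * (\<Sum>q\<in>X. f p q * G m q j))" for m i j
  show ?thesis
  proof (rule that[of F])
    show "0 < F m i j" if "i \<in> X" "j \<in> X" for m i j
    proof -
      have inner: "0 \<le> (\<Sum>q\<in>X. f p q * G m q j)" if "p \<in> X" for p
        using nonneg[OF that] G_pos by (intro sum_nonneg mult_nonneg_nonneg) (auto intro: less_imp_le)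
      \<comment> \<open>All entries of \<open>G m\<close> are positive, so the single nonzero entry
        at \<open>(a, b)\<close> makes every entry of the product positive.\<close>
      have "0 < (\<Sum>q\<in>X. f a q * G m q j)"
        using ab nonneg[OF ab(1)] G_pos X
        by (intro sum_pos2[of X b] mult_pos_pos mult_nonneg_nonneg)
           (auto intro: less_imp_le simp: less_le)
      then show ?thesis
        unfolding F_def using ab inner G_pos X
        by (intro sum_pos2[of X a]) (auto intro!: mult_nonneg_nonneg intro: less_imp_le)
    qed
    show "minors2_nonneg X \<rho> (F m)" for m
      unfolding F_def by (intro minors2_nonneg_mult inj G_minors f)
    show "(\<lambda>m. F m i j) \<longlonglongrightarrow> f i j" if ij: "i \<in> X" "j \<in> X" for i j
    proof -
      have "(\<lambda>m. F m i j) \<longlonglongrightarrow>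
          (\<Sum>p\<in>X. (if i = p then 1 else 0) * (\<Sum>q\<in>X. f p q * (if q = j then 1 else 0)))"
        unfolding F_def by (intro tendsto_intros G_lim ij)
      also have "(\<Sum>p\<in>X. (if i = p then 1 else 0) * (\<Sum>q\<in>X. f p q * (if q = j then 1 else 0)))
          = f i j"
        using X ij by (simp add: if_distrib[of "\<lambda>x. _ * x"] if_distrib[of "\<lambda>x. x * _"] cong: if_cong)
      finally show ?thesis .
    qed
  qed
qed

text \<open>The difference of the two exponents is \<open>\<epsilon>\<close> times the product of
  the two rank gaps, hence positive. Positive entries of \<open>f\<close> carry this strict
  inequality over to the minors.\<close>

lemma minors2_pos_exp_twist:
  assumes f: "minors2_nonneg X \<rho> f" and pos: "\<And>i j. i \<in> X \<Longrightarrow> j \<in> X \<Longrightarrow> 0 < f i j"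
    and "0 < \<epsilon>" "i \<in> X" "j \<in> X" "k \<in> X" "l \<in> X" "\<rho> i < \<rho> j" "\<rho> k < \<rho> l"
  defines "h \<equiv> \<lambda>i j. f i j * exp (\<epsilon> * real (\<rho> i) * real (\<rho> j))"
  shows "h i l * h j k < h i k * h j l"
proof -
  let ?a = "real (\<rho> i)" and ?b = "real (\<rho> j)" and ?c = "real (\<rho> k)" and ?d = "real (\<rho> l)"
  have "0 < \<epsilon> * ((?b - ?a) * (?d - ?c))"
    using assms by simp
  then have "\<epsilon> * ?a * ?d + \<epsilon> * ?b * ?c < \<epsilon> * ?a * ?c + \<epsilon> * ?b * ?d"
    by (simp add: algebra_simps)
  then have "f i l * f j k * exp (\<epsilon> * ?a * ?d + \<epsilon> * ?b * ?c)
      < f i k * f j l * exp (\<epsilon> * ?a * ?c + \<epsilon> * ?b * ?d)"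
    using minors2_nonnegD[OF f \<open>i \<in> X\<close> \<open>j \<in> X\<close> \<open>k \<in> X\<close> \<open>l \<in> X\<close>] assms
    by (intro mult_le_less_imp_less) auto
  then show ?thesis
    by (simp add: h_def exp_add mult_ac)
qed

text \<open>Positive entries come first, since the twist yields strict minors only for them. With
  \<epsilon> = 1/(m+1) the twisting factor tends to 1 and leaves the limit unchanged.\<close>

lemma minors2_pos_approximation:
  assumes X: "finite X" and inj: "inj_on \<rho> X"
    and nonneg: "\<And>i j. i \<in> X \<Longrightarrow> j \<in> X \<Longrightarrow> 0 \<le> f i j"
    and f: "minors2_nonneg X \<rho> f"
  obtains H :: "nat \<Rightarrow> 'a \<Rightarrow> 'a \<Rightarrow> real" where
    "\<And>m i j. i \<in> X \<Longrightarrow> j \<in> X \<Longrightarrow> 0 < H m i j"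
    "\<And>m i j k l. i \<in> X \<Longrightarrow> j \<in> X \<Longrightarrow> k \<in> X \<Longrightarrow> l \<in> X \<Longrightarrow> \<rho> i < \<rho> j \<Longrightarrow> \<rho> k < \<rho> l \<Longrightarrow>
       H m i l * H m j k < H m i k * H m j l"
    "\<And>i j. i \<in> X \<Longrightarrow> j \<in> X \<Longrightarrow> (\<lambda>m. H m i j) \<longlonglongrightarrow> f i j"
proof -
  obtain F :: "nat \<Rightarrow> 'a \<Rightarrow> 'a \<Rightarrow> real" where
    F_pos: "\<And>m i j. i \<in> X \<Longrightarrow> j \<in> X \<Longrightarrow> 0 < F m i j"
    and F_minors: "\<And>m. minors2_nonneg X \<rho> (F m)"
    and F_lim: "\<And>i j. i \<in> X \<Longrightarrow> j \<in> X \<Longrightarrow> (\<lambda>m. F m i j) \<longlonglongrightarrow> f i j"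
    using minors2_nonneg_positive_approximation[OF X inj nonneg f] by blast
  define H where
    "H m i j = F m i j * exp (inverse (real (Suc m)) * real (\<rho> i) * real (\<rho> j))" for m i j
  show ?thesis
  proof (rule that[of H])
    show "0 < H m i j" if "i \<in> X" "j \<in> X" for m i j
      using F_pos[OF that] by (simp add: H_def)
    show "H m i l * H m j k < H m i k * H m j l"
      if "i \<in> X" "j \<in> X" "k \<in> X" "l \<in> X" "\<rho> i < \<rho> j" "\<rho> k < \<rho> l" for m i j k l
      unfolding H_def by (rule minors2_pos_exp_twist[OF F_minors F_pos _ that]) auto
    show "(\<lambda>m. H m i j) \<longlonglongrightarrow> f i j" if "i \<in> X" "j \<in> X" for i j
    proof -
      have "(\<lambda>m. H m i j) \<longlonglongrightarrow> f i j * exp (0 * real (\<rho> i) * real (\<rho> j))"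
        unfolding H_def by (intro tendsto_intros F_lim that LIMSEQ_inverse_real_of_nat)
      then show ?thesis by simp
    qed
  qed
qed

section \<open>Transfer between the sign patterns and the rank order\<close>

theorem theorem11:
  fixes n :: nat and A :: "real mat" and J J2 :: "nat set"
  assumes "n \<ge> 2"
    and "A \<in> carrier_mat n n"
    and "sign_symmetric_witness A J"
    and "sign_symmetric_witness (second_compound A) J2"
    and "W_hat_transitive n J J2"
  shows "\<exists>As :: nat \<Rightarrow> real mat.
    (\<forall>m. As m \<in> carrier_mat n n \<and>
         strictly_sign_symmetric (As m) \<and>
         strictly_sign_symmetric (second_compound (As m))) \<and>
    (\<forall>i<n. \<forall>j<n. (\<lambda>m. As m $$ (i, j)) \<longlonglongrightarrow> A $$ (i, j))"
proof -
  define X where "X = {0..<n}"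
  have [simp]: "dim_row A = n" using assms(2) by simp
  let ?\<sigma> = "sign_of J"
  let ?\<tau> = "\<lambda>i j. sign_of J2 (lex_number n (i, j))"
  obtain \<rho> :: "nat \<Rightarrow> nat" where inj: "inj_on \<rho> X"
    and rank: "\<And>i j. i \<in> X \<Longrightarrow> j \<in> X \<Longrightarrow> i \<noteq> j \<Longrightarrow> (i, j) \<in> W_hat n J J2 \<longleftrightarrow> \<rho> i < \<rho> j"
    using linear_order_rank[of X "W_hat n J J2"] assms(5) by (auto simp: W_hat_transitive_def X_def)
  define s :: "nat \<Rightarrow> nat \<Rightarrow> real" where "s i j = (if \<rho> i < \<rho> j then 1 else -1)" for i j
  \<comment> \<open>The two clauses of \<open>W_hat\<close> with \<open>i < j\<close> say precisely
    that the left-hand product is -1 when \<open>i\<close> precedes \<open>j\<close>. The minus sign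
    cancels below, where row pair and column pair contribute one each.\<close>
  have sign: "?\<tau> i j * (?\<sigma> i * ?\<sigma> j) = - s i j" if "i < j" "j < n" for i j
    using rank[of i j] that
    by (auto simp: s_def X_def W_hat_def exactly_one_in_def sign_of_def)

  define f where "f i j = ?\<sigma> i * ?\<sigma> j * A $$ (i, j)" for i j
  have A_f: "A $$ (i, j) = ?\<sigma> i * ?\<sigma> j * f i j" for i j
    by (simp add: f_def sign_of_def)
  \<comment> \<open>Kept general in \<open>M\<close> and \<open>h\<close> to serve both
    \<open>A\<close> with \<open>f\<close> and the approximants with \<open>H m\<close>. The
    diagonal signs factor out of the minor by rows and columns.\<close>
  have minor: "?\<tau> i j * ?\<tau> k l * minor2 M (i, j) (k, l) = s i j * s k l * (h i k * h j l - h i l * h j k)"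
    if "i < j" "j < n" "k < l" "l < n"
      and M: "\<And>i j. i < n \<Longrightarrow> j < n \<Longrightarrow> M $$ (i, j) = ?\<sigma> i * ?\<sigma> j * h i j"
    for M h i j k l
  proof -
    have "?\<tau> i j * ?\<tau> k l * minor2 M (i, j) (k, l)
        = (?\<tau> i j * (?\<sigma> i * ?\<sigma> j)) * (?\<tau> k l * (?\<sigma> k * ?\<sigma> l)) * (h i k * h j l - h i l * h j k)"
      using that(1-4) by (simp add: minor2_def M algebra_simps)
    also have "\<dots> = s i j * s k l * (h i k * h j l - h i l * h j k)"
      using sign[of i j] sign[of k l] that(1-4) by simp
    finally show ?thesis .
  qed

  have "0 \<le> f i j" if "i \<in> X" "j \<in> X" for i j
    using sign_symmetric_witness_nonneg[OF assms(3)] that by (simp add: f_def X_def)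
  moreover have "minors2_nonneg X \<rho> f"
  proof -
    have ordered: "0 \<le> s i j * s k l * (f i k * f j l - f i l * f j k)"
      if "i < j" "j < n" "k < l" "l < n" for i j k l
    proof -
      have "0 \<le> ?\<tau> i j * ?\<tau> k l * second_compound A $$ (lex_number n (i, j), lex_number n (k, l))"
        using that by (intro sign_symmetric_witness_nonneg[OF assms(4)])
          (simp_all add: lex_pairs_nth_lex_number)
      then show ?thesis
        using that minor[OF that A_f]
        by (simp add: second_compound_nth lex_pairs_nth_lex_number)
    qed
    show ?thesis
      unfolding minors2_nonneg_def
    proof (intro ballI impI)
      fix i j k l
      assume "i \<in> X" "j \<in> X" "k \<in> X" "l \<in> X" and r: "\<rho> i < \<rho> j" "\<rho> k < \<rho> l"
      then have n: "i < n" "j < n" "k < n" "l < n" by (simp_all add: X_def)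
      \<comment> \<open>The compound only records pairs in numerical order. Exchanging two rows or
        two columns negates both the minor and the matching \<open>s\<close>, so all four
        arrangements reduce to \<open>ordered\<close>.\<close>
      have "i < j \<or> j < i" "k < l \<or> l < k" using r by (metis linorder_neqE_nat less_irrefl)+
      then show "f i l * f j k \<le> f i k * f j l"
        using r n ordered[of i j k l] ordered[of i j l k] ordered[of j i k l] ordered[of j i l k]
        by (auto simp: s_def mult.commute)
    qed
  qed
  ultimately obtain H :: "nat \<Rightarrow> nat \<Rightarrow> nat \<Rightarrow> real" where
    H_pos: "\<And>m i j. i \<in> X \<Longrightarrow> j \<in> X \<Longrightarrow> 0 < H m i j"
    and H_minors: "\<And>m i j k l. i \<in> X \<Longrightarrow> j \<in> X \<Longrightarrow> k \<in> X \<Longrightarrow> l \<in> X \<Longrightarrow>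
       \<rho> i < \<rho> j \<Longrightarrow> \<rho> k < \<rho> l \<Longrightarrow> H m i l * H m j k < H m i k * H m j l"
    and H_lim: "\<And>i j. i \<in> X \<Longrightarrow> j \<in> X \<Longrightarrow> (\<lambda>m. H m i j) \<longlonglongrightarrow> f i j"
    using minors2_pos_approximation[of X \<rho> f] inj by (auto simp: X_def)

  \<comment> \<open>Undoing the conjugation restores the sign patterns, with the same witnesses
    \<open>J\<close> and \<open>J2\<close>.\<close>
  define As where "As m = mat n n (\<lambda>(i, j). ?\<sigma> i * ?\<sigma> j * H m i j)" for m
  have As_dim: "dim_row (As m) = n" "dim_col (As m) = n" for m by (simp_all add: As_def)
  have As_nth: "As m $$ (i, j) = ?\<sigma> i * ?\<sigma> j * H m i j" if "i < n" "j < n" for m i j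
    using that by (simp add: As_def)
  have "strictly_sign_symmetric (As m)" for m
  proof (rule strictly_sign_symmetricI)
    show "0 < ?\<sigma> i * ?\<sigma> j * As m $$ (i, j)" if "i < dim_row (As m)" "j < dim_row (As m)" for i j
      using that H_pos[of i j m] by (auto simp: As_dim As_nth X_def sign_of_def)
    show "J \<subseteq> {0..<dim_row (As m)}"
      using assms(3) by (simp add: As_dim sign_symmetric_witness_def)
  qed (simp add: As_dim)
  moreover have "strictly_sign_symmetric (second_compound (As m))" for m
  proof (rule strictly_sign_symmetricI)
    show "0 < sign_of J2 a * sign_of J2 b * second_compound (As m) $$ (a, b)"
      if "a < dim_row (second_compound (As m))" "b < dim_row (second_compound (As m))" for a b
    proof -
      have ab: "a < n choose 2" "b < n choose 2" using that by (simp_all add: As_dim)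
      obtain i j where ij: "i < j" "j < n" "lex_pairs n ! a = (i, j)" "lex_number n (i, j) = a"
        using lex_pairs_nthE[OF ab(1)] .
      obtain k l where kl: "k < l" "l < n" "lex_pairs n ! b = (k, l)" "lex_number n (k, l) = b"
        using lex_pairs_nthE[OF ab(2)] .
      have X: "i \<in> X" "j \<in> X" "k \<in> X" "l \<in> X" using ij kl by (simp_all add: X_def)
      have ne: "\<rho> i \<noteq> \<rho> j" "\<rho> k \<noteq> \<rho> l"
        using inj X ij(1) kl(1) by (metis inj_onD less_irrefl)+
      \<comment> \<open>Whichever way the ranks order the two pairs, the factors \<open>s\<close>
        compensate for the sign of the minor of \<open>H m\<close>.\<close>
      have "0 < s i j * s k l * (H m i k * H m j l - H m i l * H m j k)"
        using ne H_minors[of i j k l m] H_minors[of i j l k m] H_minors[of j i k l m]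
          H_minors[of j i l k m] X
        by (auto simp: s_def mult.commute)
      also have "\<dots> = sign_of J2 a * sign_of J2 b * minor2 (As m) (i, j) (k, l)"
        using minor[OF ij(1,2) kl(1,2), of "As m" "H m"] As_nth ij kl by simp
      finally show ?thesis
        using ab ij kl by (simp add: second_compound_nth As_dim)
    qed
    show "J2 \<subseteq> {0..<dim_row (second_compound (As m))}"
      using assms(4) by (simp add: As_dim sign_symmetric_witness_def)
  qed simp
  moreover have "(\<lambda>m. As m $$ (i, j)) \<longlonglongrightarrow> A $$ (i, j)" if "i < n" "j < n" for i j
  proof -
    have "(\<lambda>m. ?\<sigma> i * ?\<sigma> j * H m i j) \<longlonglongrightarrow> ?\<sigma> i * ?\<sigma> j * f i j"
      using that by (intro tendsto_intros H_lim) (simp_all add: X_def)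
    then show ?thesis using that by (simp add: As_nth A_f)
  qed
  ultimately show ?thesis
    by (intro exI[of _ As]) (auto simp: As_def)
qed

end
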